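(* The following inequalities hold: $FC(4,9)\ge 14$, $FC(4,10)\ge 16$, $FC(5,8)\ge 21$, $FC(5,9)\ge 31$, $FC(5,10)\ge 44$, $FC(6,9)\ge 42$, $FC(6,10)\ge 71$, $FC(7,10)\ge 85$. Moreover, $FC(k,n)$ is undefined for every pair of integers $(k,n)$ with $5\le k<n\le 10$ other than $(5,7),(5,8),(5,9),(5,10),(6,8),(6,9),(6,10),(7,10)$.
   Context: All families are finite families of finite sets. A family $\mathcal{F}$ is union-closed if $A\cup B\in\mathcal{F}$ for all $A,B\in\mathcal{F}$. For a family $\mathcal{F}$, write $U(\mathcal{F})=\bigcup_{S\in\mathcal{F}}S$ for its ground set (universe) and $\mathcal{F}_i=\{S\in\mathcal{F}: i\in S\}$. A family $\mathcal{A}$ is Frankl-Complete (FC) if for every union-closed family $\mathcal{F}\supseteq\mathcal{A}$ there is some $i\in U(\mathcal{A})$ with $|\mathcal{F}_i|\ge|\mathcal{F}|/2$. Write $[n]=\{1,\dots,n\}$ and $\mathcal{P}([n])$ for its power set; a $k$-set is a set with exactly $k$ elements. For $3\le k<n$, $FC(k,n)$ is the least integer $m$ such that every family $\mathcal{A}\subseteq\mathcal{P}([n])$ containing $m$ distinct $k$-sets is FC. Thus $FC(k,n)\ge m$ means that there is a family $\mathcal{A}\subseteq\mathcal{P}([n])$ containing $m-1$ distinct $k$-sets that is not FC. $FC(k,n)$ is called undefined if even the family $\binom{[n]}{k}$ of all $k$-subsets of $[n]$ is not FC. *)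

theory Defs
  imports Complex_Main
begin

(* All families live over nat.  A finite family of finite sets over any other type can be
   relabelled, keeping its ground elements in [n] fixed, so nothing is lost. *)

definition union_closed :: "nat set set \<Rightarrow> bool" where
  "union_closed \<F> \<longleftrightarrow> (\<forall>A\<in>\<F>. \<forall>B\<in>\<F>. A \<union> B \<in> \<F>)"

definition members_containing :: "nat set set \<Rightarrow> nat \<Rightarrow> nat set set" where
  "members_containing \<F> i = {S \<in> \<F>. i \<in> S}"

definition frankl_complete :: "nat set set \<Rightarrow> bool" where
  "frankl_complete \<A> \<longleftrightarrow>
     (\<forall>\<F>. finite \<F> \<longrightarrow> (\<forall>S\<in>\<F>. finite S) \<longrightarrow> union_closed \<F> \<longrightarrow> \<A> \<subseteq> \<F> \<longrightarrow>
        (\<exists>i\<in>\<Union>\<A>. real (card (members_containing \<F> i)) \<ge> real (card \<F>) / 2))"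

definition k_subsets :: "nat \<Rightarrow> nat \<Rightarrow> nat set set" where
  "k_subsets k n = {S. S \<subseteq> {1..n} \<and> card S = k}"

(* The family may contain further sets, of any size, besides the m distinct k-sets. *)
definition contains_k_sets :: "nat set set \<Rightarrow> nat \<Rightarrow> nat \<Rightarrow> bool" where
  "contains_k_sets \<A> m k \<longleftrightarrow> (\<exists>\<K>\<subseteq>\<A>. card \<K> = m \<and> finite \<K> \<and> (\<forall>S\<in>\<K>. finite S \<and> card S = k))"

(* The defining set is never empty, since every m > (n choose k) qualifies vacuously.  So in
   the undefined case this total function takes the junk value (n choose k) + 1, and a lower
   bound FC k n >= m has the meaning given by le_FC_iff whether or not FC k n is defined. *)
definition FC :: "nat \<Rightarrow> nat \<Rightarrow> nat" where
  "FC k n = (LEAST m. \<forall>\<A>\<subseteq>Pow {1..n}. contains_k_sets \<A> m k \<longrightarrow> frankl_complete \<A>)"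

definition FC_undefined :: "nat \<Rightarrow> nat \<Rightarrow> bool" where
  "FC_undefined k n \<longleftrightarrow> \<not> frankl_complete (k_subsets k n)"

lemma contains_k_sets_mono:
  assumes "contains_k_sets \<A> m k" and "m' \<le> m"
  shows "contains_k_sets \<A> m' k"
proof -
  obtain \<K> where K: "\<K> \<subseteq> \<A>" "card \<K> = m" "finite \<K>" "\<forall>S\<in>\<K>. finite S \<and> card S = k"
    using assms(1) unfolding contains_k_sets_def by blast
  obtain \<L> where "\<L> \<subseteq> \<K>" "card \<L> = m'" "finite \<L>"
    using obtain_subset_with_card_n[of m' \<K>] K(2) assms(2) by auto
  then show ?thesis using K unfolding contains_k_sets_def by blast
qed

lemma le_FC_iff:
  assumes "m \<ge> 1"
  shows "FC k n \<ge> m \<longleftrightarrow>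
    (\<exists>\<A>\<subseteq>Pow {1..n}. contains_k_sets \<A> (m - 1) k \<and> \<not> frankl_complete \<A>)"
proof -
  let ?P = "\<lambda>m. \<forall>\<A>\<subseteq>Pow {1..n}. contains_k_sets \<A> m k \<longrightarrow> frankl_complete \<A>"
  have "?P (Suc (card (Pow {1..n})))"
  proof (intro allI impI)
    fix \<A> :: "nat set set"
    assume sub: "\<A> \<subseteq> Pow {1..n}" and "contains_k_sets \<A> (Suc (card (Pow {1..n}))) k"
    then obtain \<K> where "\<K> \<subseteq> \<A>" and c: "card \<K> = Suc (card (Pow {1..n}))"
      unfolding contains_k_sets_def by blast
    with sub have "card \<K> \<le> card (Pow {1..n})"
      by (intro card_mono) auto
    with c show "frankl_complete \<A>" by simp
  qed
  then have P: "?P (FC k n)" unfolding FC_def by (rule LeastI)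
  have mono: "?P m2" if "?P m1" "m1 \<le> m2" for m1 m2
    using that contains_k_sets_mono by blast
  have "FC k n \<ge> m \<longleftrightarrow> \<not> ?P (m - 1)"
  proof
    assume "FC k n \<ge> m"
    then have "m - 1 < FC k n" using assms by simp
    then show "\<not> ?P (m - 1)" unfolding FC_def by (rule not_less_Least)
  next
    assume "\<not> ?P (m - 1)"
    then have "\<not> FC k n \<le> m - 1" using mono[OF P] by blast
    then show "FC k n \<ge> m" by simp
  qed
  then show ?thesis by blast
qed

end

theory Submission
  imports Defs
begin

text \<open>
  By Poonen's argument, \<open>\<A>\<close> is not FC as soon as there are union-closed families
  \<open>\<B>\<^sub>1, \<dots>, \<B>\<^sub>r\<close> of subsets of \<open>{1..n}\<close>, each closed under union with members of \<open>\<A>\<close>,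
  such that on average over these families every element lies in fewer than half of the sets.
  Indeed, put copies of the \<open>\<B>\<^sub>i\<close> above the complements of the singletons of a large fresh
  set \<open>I\<close>, the full power set of \<open>{1..n}\<close> above \<open>I\<close>, and a family containing \<open>\<A>\<close> above
  the empty set; distinct copies do not interact, and the last two layers have bounded weight.

  All families \<open>\<B>\<close> used here consist of the sets avoiding one element \<open>i\<close>, together with the
  sets containing one of finitely many generators, among them all members of \<open>\<A>\<close> through \<open>i\<close>.
  Averages are given by integer weights found by linear programming.
\<close>

section \<open>Biases and Poonen's construction\<close>

text \<open>For a finite family, \<open>j\<close> lies in fewer than half of the sets exactly when
  the bias is negative. The bias is additive over disjoint families, so averages become integer
  sums.\<close>

definition bias :: "nat set set \<Rightarrow> nat \<Rightarrow> int" where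
  "bias \<B> j = (\<Sum>S\<in>\<B>. if j \<in> S then 1 else -1)"

lemma bias_eq_card:
  assumes "finite \<B>"
  shows "bias \<B> j = 2 * int (card (members_containing \<B> j)) - int (card \<B>)"
proof -
  have "bias \<B> j = (\<Sum>S\<in>\<B>. 2 * (if j \<in> S then 1 else 0) - 1)"
    unfolding bias_def by (rule sum.cong) auto
  also have "\<dots> = 2 * (\<Sum>S\<in>\<B>. if j \<in> S then 1 else 0) - int (card \<B>)"
    by (simp add: sum_subtractf sum_distrib_left)
  also have "(\<Sum>S\<in>\<B>. if j \<in> S then 1 else 0) = int (card (members_containing \<B> j))"
    using assms by (simp add: members_containing_def sum.inter_filter[symmetric])
  finally show ?thesis .
qed

lemma not_frankl_completeI:
  assumes "finite \<F>" "\<And>S. S \<in> \<F> \<Longrightarrow> finite S" "union_closed \<F>" "\<A> \<subseteq> \<F>"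
    and neg: "\<And>j. j \<in> \<Union>\<A> \<Longrightarrow> bias \<F> j < 0"
  shows "\<not> frankl_complete \<A>"
proof
  assume "frankl_complete \<A>"
  then obtain j where j: "j \<in> \<Union>\<A>"
    and ge: "real (card (members_containing \<F> j)) \<ge> real (card \<F>) / 2"
    using assms(1-4) unfolding frankl_complete_def by meson
  show False
    using neg[OF j] ge unfolding bias_eq_card[OF assms(1)] by linarith
qed

lemma bias_le_card: "bias \<B> j \<le> int (card \<B>)"
  unfolding bias_def by (rule sum_bounded_above[of _ _ 1, simplified]) auto

lemma bias_Un_disjoint:
  assumes "finite \<B>" "finite \<C>" "\<B> \<inter> \<C> = {}"
  shows "bias (\<B> \<union> \<C>) j = bias \<B> j + bias \<C> j"
  unfolding bias_def using assms by (rule sum.union_disjoint)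

lemma bias_add_outside:
  assumes "\<B> \<subseteq> Pow V" "V \<inter> R = {}" "j \<notin> R"
  shows "bias ((\<lambda>X. X \<union> R) ` \<B>) j = bias \<B> j"
proof -
  have "inj_on (\<lambda>X. X \<union> R) \<B>"
    using assms(1,2) by (intro inj_onI) blast
  then show ?thesis
    unfolding bias_def using assms(3) by (simp add: sum.reindex)
qed

text \<open>\<open>Bs\<close> is a list because repetitions serve as integer weights. Repeating the
  whole list \<open>K\<close> times makes the negative total outweigh the two layers of bounded
  size.\<close>

lemma not_frankl_complete_if_sum_bias:
  assumes A: "\<A> \<subseteq> Pow {1..n}"
    and sub: "\<And>\<B>. \<B> \<in> set Bs \<Longrightarrow> \<B> \<subseteq> Pow {1..n}"
    and uc: "\<And>\<B>. \<B> \<in> set Bs \<Longrightarrow> union_closed \<B>"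
    and cl: "\<And>\<B> X Y. \<B> \<in> set Bs \<Longrightarrow> X \<in> \<A> \<Longrightarrow> Y \<in> \<B> \<Longrightarrow> X \<union> Y \<in> \<B>"
    and neg: "\<And>j. j \<in> {1..n} \<Longrightarrow> (\<Sum>\<B>\<leftarrow>Bs. bias \<B> j) < 0"
  shows "\<not> frankl_complete \<A>"
proof -
  define V where "V = {1..n}"
  have finV: "finite V" by (simp add: V_def)
  \<comment> \<open>\<open>2 * 2 ^ n\<close> bounds the sizes of \<open>\<G>\<close> and
    \<open>\<P>\<close> together, and \<open>K\<close> must exceed it. The summand 2 also shows at
    once that \<open>I\<close> has at least two elements when \<open>Bs\<close> is nonempty.\<close>
  define K where "K = 2 * 2 ^ n + (2::nat)"
  define Cs where "Cs = concat (replicate K Bs)"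
  have setCs: "set Cs = set Bs" by (simp add: Cs_def K_def)
  define I where "I = {n+1..<n+1+length Cs}"
  have finI: "finite I" by (simp add: I_def)
  have VI: "V \<inter> I = {}" by (auto simp: V_def I_def)
  define b where "b f = Cs ! (f - (n+1))" for f
  have b: "b f \<in> set Bs" if "f \<in> I" for f
    using that nth_mem[of "f - (n+1)" Cs] unfolding b_def I_def setCs by auto
  have bsub: "b f \<subseteq> Pow V" if "f \<in> I" for f
    using sub[OF b[OF that]] by (simp add: V_def)
  \<comment> \<open>the largest family above the empty set that the closure conditions allow\<close>
  define \<G> where "\<G> = {X. X \<subseteq> V \<and> (\<forall>\<B>\<in>set Bs. \<forall>Y\<in>\<B>. X \<union> Y \<in> \<B>)}"
  define M where "M f = (\<lambda>X. X \<union> (I - {f})) ` b f" for f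
  define \<P> where "\<P> = (\<lambda>X. X \<union> I) ` Pow V"
  define \<F> where "\<F> = (\<G> \<union> (\<Union>f\<in>I. M f)) \<union> \<P>"
  have finG: "finite \<G>" unfolding \<G>_def using finV by simp
  have finM: "finite (M f)" if "f \<in> I" for f
    unfolding M_def using finite_subset[OF bsub[OF that]] finV by simp
  have finP: "finite \<P>" unfolding \<P>_def using finV by simp
  have F_P: "S \<union> T \<in> \<P>" if "S \<subseteq> V \<union> I" "T \<subseteq> V \<union> I" "I \<subseteq> S \<union> T" for S T
  proof -
    have "S \<union> T = ((S \<union> T) \<inter> V) \<union> I" using that by blast
    then show ?thesis unfolding \<P>_def by blast
  qed
  have FVI: "S \<subseteq> V \<union> I" if "S \<in> \<F>" for S
    using that bsub unfolding \<F>_def \<G>_def M_def \<P>_def by blast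
  have GM: "S \<union> T \<in> M f" if "S \<in> \<G>" "T \<in> M f" "f \<in> I" for S T f
  proof -
    obtain Y where Y: "Y \<in> b f" "T = Y \<union> (I - {f})" using \<open>T \<in> M f\<close> unfolding M_def by blast
    have "S \<union> Y \<in> b f" using that(1) Y(1) b[OF that(3)] unfolding \<G>_def by blast
    then show ?thesis unfolding M_def Y(2) by (metis Un_assoc image_eqI)
  qed
  have MM: "S \<union> T \<in> \<F>" if fg: "S \<in> M f" "T \<in> M g" "f \<in> I" "g \<in> I" for S T f g
  proof (cases "f = g")
    case True
    obtain X Y where XY: "X \<in> b f" "Y \<in> b f" "S = X \<union> (I - {f})" "T = Y \<union> (I - {f})"
      using fg True unfolding M_def by blast
    have "X \<union> Y \<in> b f"
      using uc[OF b[OF fg(3)]] XY unfolding union_closed_def by blast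
    moreover have "S \<union> T = (X \<union> Y) \<union> (I - {f})" using XY by blast
    ultimately show ?thesis using fg(3) unfolding \<F>_def M_def by blast
  next
    case False
    have "S \<subseteq> V \<union> I" "T \<subseteq> V \<union> I"
      using fg FVI unfolding \<F>_def by blast+
    \<comment> \<open>The complements in \<open>I\<close> of two distinct points cover
      \<open>I\<close>, so the union lands in the full power set layer, whatever \<open>b f\<close>
      and \<open>b g\<close> are.\<close>
    moreover have "I \<subseteq> S \<union> T" using fg False unfolding M_def by blast
    ultimately have "S \<union> T \<in> \<P>" by (rule F_P)
    then show ?thesis unfolding \<F>_def by blast
  qed
  have ucF: "union_closed \<F>"
    unfolding union_closed_def
  proof (intro ballI)
    fix S T assume S: "S \<in> \<F>" and T: "T \<in> \<F>"
    note ST = FVI[OF S] FVI[OF T]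
    show "S \<union> T \<in> \<F>"
    proof (cases "S \<in> \<P> \<or> T \<in> \<P>")
      case True
      then have "I \<subseteq> S \<union> T" unfolding \<P>_def by blast
      with ST have "S \<union> T \<in> \<P>" by (intro F_P)
      then show ?thesis unfolding \<F>_def by blast
    next
      case False
      then consider "S \<in> \<G>" "T \<in> \<G>" | f where "S \<in> \<G>" "f \<in> I" "T \<in> M f"
        | f where "T \<in> \<G>" "f \<in> I" "S \<in> M f"
        | f g where "f \<in> I" "S \<in> M f" "g \<in> I" "T \<in> M g"
        using S T unfolding \<F>_def by blast
      then show ?thesis
      proof cases
        case 1
        then have "S \<union> T \<in> \<G>" unfolding \<G>_def by (auto simp: Un_assoc)
        then show ?thesis unfolding \<F>_def by blast
      next
        case 2
        then have "S \<union> T \<in> M f" by (intro GM)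
        then show ?thesis using 2 unfolding \<F>_def by blast
      next
        case 3
        then have "T \<union> S \<in> M f" by (intro GM)
        then show ?thesis using 3 unfolding \<F>_def by (auto simp: Un_commute)
      next
        case 4
        then show ?thesis by (intro MM)
      qed
    qed
  qed
  have biasF: "bias \<F> j < 0" if j: "j \<in> V" for j
  proof -
    have jI: "j \<notin> I" using j VI by blast
    have neg': "(\<Sum>\<B>\<leftarrow>Bs. bias \<B> j) < 0" using neg j by (simp add: V_def)
    then have "Bs \<noteq> []" by auto
    then have "length Bs \<ge> 1" by (cases Bs) auto
    then have "2 * 1 \<le> K * length Bs" by (intro mult_le_mono) (auto simp: K_def)
    moreover have "card I = K * length Bs"
      by (simp add: I_def Cs_def length_concat sum_list_replicate)
    ultimately have cI: "card I \<ge> 2" by simp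
    \<comment> \<open>The layers are told apart by their traces on \<open>I\<close>, namely the
      empty set, \<open>I - {f}\<close> and \<open>I\<close>. The first two differ because
      \<open>I\<close> has at least two elements.\<close>
    have ne: "I - {f} \<noteq> {}" for f
    proof
      assume "I - {f} = {}"
      then have "card I \<le> card {f}" by (intro card_mono) auto
      with cI show False by simp
    qed
    have MI: "S \<inter> I = I - {f}" if "S \<in> M f" "f \<in> I" for S f
      using that bsub[OF that(2)] VI unfolding M_def by blast
    have GI: "S \<inter> I = {}" if "S \<in> \<G>" for S
      using that VI unfolding \<G>_def by blast
    have PI: "S \<inter> I = I" if "S \<in> \<P>" for S
      using that unfolding \<P>_def by blast
    have dis1: "\<G> \<inter> (\<Union>f\<in>I. M f) = {}"
      by (intro equals0I) (metis GI MI ne IntE UN_E)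
    have dis2: "(\<G> \<union> (\<Union>f\<in>I. M f)) \<inter> \<P> = {}"
    proof (intro equals0I)
      fix S assume S: "S \<in> (\<G> \<union> (\<Union>f\<in>I. M f)) \<inter> \<P>"
      then have SI: "S \<inter> I = I" by (simp add: PI)
      from S consider "S \<in> \<G>" | f where "f \<in> I" "S \<in> M f" by blast
      then show False
      proof cases
        case 1
        then show False using SI GI[OF 1] ne by auto
      next
        case 2
        then show False using SI MI[OF 2(2,1)] by blast
      qed
    qed
    have dis3: "M f \<inter> M g = {}" if "f \<in> I" "g \<in> I" "f \<noteq> g" for f g
    proof (intro equals0I)
      fix S assume "S \<in> M f \<inter> M g"
      then have "I - {f} = I - {g}" using MI[of S f] MI[of S g] that(1,2) by blast
      then show False using that by blast
    qed
    have "bias (\<Union>f\<in>I. M f) j = (\<Sum>f\<in>I. bias (M f) j)"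
      unfolding bias_def using finI finM dis3 by (intro sum.UNION_disjoint) auto
    also have "\<dots> = (\<Sum>f\<in>I. bias (b f) j)"
      unfolding M_def
    proof (intro sum.cong refl bias_add_outside)
      show "b f \<subseteq> Pow V" if "f \<in> I" for f using bsub that .
    qed (use VI jI in auto)
    also have "\<dots> = (\<Sum>t\<in>{0..<length Cs}. bias (Cs ! t) j)"
      unfolding I_def b_def
      by (rule sum.reindex_bij_witness[of _ "\<lambda>t. t + (n+1)" "\<lambda>f. f - (n+1)"]) auto
    also have "\<dots> = (\<Sum>\<B>\<leftarrow>Cs. bias \<B> j)"
      by (simp add: sum_list_sum_nth)
    also have "\<dots> = int K * (\<Sum>\<B>\<leftarrow>Bs. bias \<B> j)"
      unfolding Cs_def by (induction K) (auto simp: algebra_simps)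
    \<comment> \<open>A negative integer is at most -1.\<close>
    also have "\<dots> \<le> int K * (-1)"
      using neg' by (intro mult_left_mono) auto
    finally have bM: "bias (\<Union>f\<in>I. M f) j \<le> - int K" by simp
    have "card \<G> \<le> card (Pow V)"
      unfolding \<G>_def using finV by (intro card_mono) auto
    moreover have "card \<P> \<le> card (Pow V)"
      unfolding \<P>_def using finV by (intro card_image_le) auto
    moreover have "card (Pow V) = 2 ^ n" by (simp add: card_Pow V_def)
    ultimately have "card \<G> + card \<P> < K" unfolding K_def by linarith
    moreover have "bias \<F> j = bias \<G> j + bias (\<Union>f\<in>I. M f) j + bias \<P> j"
      unfolding \<F>_def using finG finM finI finP dis1 dis2 by (simp add: bias_Un_disjoint)
    ultimately show ?thesis
      using bM bias_le_card[of \<G> j] bias_le_card[of \<P> j] by linarith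
  qed
  show ?thesis
  proof (rule not_frankl_completeI)
    show "finite \<F>" unfolding \<F>_def using finG finM finI finP by simp
    show "finite S" if "S \<in> \<F>" for S
      using FVI[OF that] finV finI by (meson finite_UnI finite_subset)
    show "union_closed \<F>" by (fact ucF)
    show "\<A> \<subseteq> \<F>" unfolding \<F>_def \<G>_def using A cl by (auto simp: V_def)
    show "bias \<F> j < 0" if "j \<in> \<Union>\<A>" for j
      using that A by (intro biasF) (unfold V_def, blast)
  qed
qed

section \<open>Boolean lists as subsets of \<open>{1..n}\<close>\<close>

text \<open>A Boolean list of length \<open>n\<close> encodes a subset of \<open>{1..n}\<close>; its head stands for the
  element \<open>n\<close>, so that recursion on the list removes the largest element.\<close>

fun dec :: "bool list \<Rightarrow> nat set" where
  "dec [] = {}"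
| "dec (x # xs) = (if x then insert (Suc (length xs)) (dec xs) else dec xs)"

lemma dec_subset: "dec xs \<subseteq> {1..length xs}"
  by (induction xs) auto

lemma finite_dec [simp]: "finite (dec xs)"
  by (rule finite_subset[OF dec_subset]) simp

lemma Suc_length_notin_dec [simp]: "Suc (length xs) \<notin> dec xs"
  using dec_subset[of xs] by auto

lemma card_dec: "card (dec xs) = count_list xs True"
  by (induction xs) auto

lemma diff_mem_dec_iff: "p < length xs \<Longrightarrow> length xs - p \<in> dec xs \<longleftrightarrow> xs ! p"
proof (induction xs arbitrary: p)
  case (Cons x xs)
  show ?case
  proof (cases p)
    case 0
    then show ?thesis by simp
  next
    case (Suc q)
    with Cons show ?thesis by auto
  qed
qed simp

lemma dec_inject: "length xs = length ys \<Longrightarrow> dec xs = dec ys \<longleftrightarrow> xs = ys"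
proof
  assume l: "length xs = length ys" and "dec xs = dec ys"
  then show "xs = ys" using diff_mem_dec_iff[of _ xs] diff_mem_dec_iff[of _ ys]
    by (intro nth_equalityI) auto
qed simp

section \<open>Biases of up-sets by recursion on the ground set\<close>

definition up :: "nat \<Rightarrow> bool list list \<Rightarrow> nat set set" where
  "up n L = {X. X \<subseteq> {1..n} \<and> (\<exists>l\<in>set L. dec l \<subseteq> X)}"

text \<open>The biases are listed for the elements \<open>n, \<dots>, 1\<close>. An empty generator yields the whole
  power set, whose biases vanish.\<close>

fun up_bias :: "nat \<Rightarrow> bool list list \<Rightarrow> int \<times> int list" where
  "up_bias 0 L = (if L = [] then 0 else 1, [])"
| "up_bias (Suc m) L =
     (if L = [] then (0, replicate (Suc m) 0)
      else if list_ex (list_all Not) L then (2 ^ Suc m, replicate (Suc m) 0)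
      else let (N1, v1) = up_bias m (map tl L);
               (N0, v0) = up_bias m (map tl (filter (\<lambda>l. \<not> hd l) L))
           in (N1 + N0, (N1 - N0) # map2 (+) v1 v0))"

lemma up_subset: "up n L \<subseteq> Pow {1..n}"
  unfolding up_def by blast

lemma finite_up [simp]: "finite (up n L)"
  by (rule finite_subset[OF up_subset]) simp

lemma bias_insert_image:
  assumes "\<B> \<subseteq> Pow {1..m}"
  shows "bias (insert (Suc m) ` \<B>) j = (if j = Suc m then int (card \<B>) else bias \<B> j)"
proof -
  have "inj_on (insert (Suc m)) \<B>"
    using assms by (intro inj_onI) (metis Diff_insert_absorb PowD Suc_n_not_le_n atLeastAtMost_iff subsetD)
  then show ?thesis
    unfolding bias_def by (simp add: sum.reindex)
qed

lemma bias_notin: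
  assumes "\<B> \<subseteq> Pow V" "j \<notin> V"
  shows "bias \<B> j = - int (card \<B>)"
proof -
  have "bias \<B> j = (\<Sum>S\<in>\<B>. -1)"
    unfolding bias_def using assms by (intro sum.cong) auto
  then show ?thesis by simp
qed

lemma Pow_Suc: "Pow {1..Suc m} = insert (Suc m) ` Pow {1..m} \<union> Pow {1..m}"
  by (simp add: atLeastAtMostSuc_conv Pow_insert Un_commute)

lemma Suc_notin: "X \<subseteq> {1..m} \<Longrightarrow> Suc m \<notin> X"
  by auto

lemma up_Suc:
  assumes "\<forall>l\<in>set L. length l = Suc m"
  shows "up (Suc m) L =
    insert (Suc m) ` up m (map tl L) \<union> up m (map tl (filter (\<lambda>l. \<not> hd l) L))"
proof -
  have dec1: "dec l \<subseteq> insert (Suc m) X \<longleftrightarrow> dec (tl l) \<subseteq> X" if "l \<in> set L" "X \<subseteq> {1..m}" for l X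
  proof -
    obtain x xs where l: "l = x # xs" "length xs = m" using assms \<open>l \<in> set L\<close> by (cases l) auto
    then have "Suc m \<notin> dec xs" using Suc_length_notin_dec[of xs] by simp
    then show ?thesis using l by auto
  qed
  have dec0: "dec l \<subseteq> X \<longleftrightarrow> \<not> hd l \<and> dec (tl l) \<subseteq> X" if "l \<in> set L" "X \<subseteq> {1..m}" for l X
  proof -
    obtain x xs where l: "l = x # xs" "length xs = m" using assms \<open>l \<in> set L\<close> by (cases l) auto
    then show ?thesis using Suc_notin[OF that(2)] by auto
  qed
  define Q where "Q X \<longleftrightarrow> (\<exists>l\<in>set L. dec l \<subseteq> X)" for X
  have "up (Suc m) L = {X \<in> Pow {1..Suc m}. Q X}"
    by (auto simp: up_def Q_def)
  also have "\<dots> = insert (Suc m) ` {Y \<in> Pow {1..m}. Q (insert (Suc m) Y)} \<union> {X \<in> Pow {1..m}. Q X}"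
    unfolding Pow_Suc by blast
  also have "{Y \<in> Pow {1..m}. Q (insert (Suc m) Y)} = up m (map tl L)"
    unfolding up_def Q_def by (simp add: dec1 cong: conj_cong)
  also have "{X \<in> Pow {1..m}. Q X} = up m (map tl (filter (\<lambda>l. \<not> hd l) L))"
  proof -
    have "Q X \<longleftrightarrow> (\<exists>l\<in>set (map tl (filter (\<lambda>l. \<not> hd l) L)). dec l \<subseteq> X)" if "X \<subseteq> {1..m}" for X
      using dec0[OF _ that] unfolding Q_def by auto
    then show ?thesis unfolding up_def by blast
  qed
  finally show ?thesis .
qed

text \<open>Adding \<open>j\<close> pairs the subsets without \<open>j\<close> with those containing
  it, so the signs cancel.\<close>

lemma bias_Pow_finite:
  assumes "finite V" "j \<in> V"
  shows "bias (Pow V) j = 0"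
proof -
  obtain W where W: "V = insert j W" "j \<notin> W" using assms(2) by (meson mk_disjoint_insert)
  have "inj_on (insert j) (Pow W)" using W(2) by (intro inj_onI) (metis Diff_insert_absorb PowD subsetD)
  then have "bias (insert j ` Pow W) j = int (card (Pow W))"
    unfolding bias_def by (simp add: sum.reindex)
  moreover have "bias (Pow W) j = - int (card (Pow W))"
    by (rule bias_notin[OF order_refl]) fact
  moreover have "Pow W \<inter> insert j ` Pow W = {}" using W(2) by blast
  ultimately show ?thesis
    using W assms(1) by (simp add: Pow_insert bias_Un_disjoint)
qed

text \<open>The cardinality is carried along because the bias at the largest element is the
  difference of the sizes of the two halves; at smaller elements the biases of the halves
  add.\<close>

lemma up_bias_correct:
  assumes "\<forall>l\<in>set L. length l = n"
  shows "up_bias n L = (int (card (up n L)), map (bias (up n L)) (rev [1..<Suc n]))"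
  using assms
proof (induction n arbitrary: L)
  case 0
  \<comment> \<open>A generator of length 0 decodes to the empty set, the only subset of the empty
    ground set.\<close>
  then have "up 0 L = (if L = [] then {} else {{}})"
    by (cases L) (auto simp: up_def)
  then show ?case by simp
next
  case (Suc m)
  consider "L = []" | "L \<noteq> []" "list_ex (list_all Not) L" | "L \<noteq> []" "\<not> list_ex (list_all Not) L"
    by blast
  then show ?case
  proof cases
    case 1
    then have "up (Suc m) L = {}" by (simp add: up_def)
    then show ?thesis using 1 by (simp add: bias_def map_replicate_const)
  next
    case 2
    then obtain l where l: "l \<in> set L" "list_all Not l" by (auto simp: list_ex_iff)
    from l(2) have "dec l = {}" by (induction l) auto
    with l(1) have U: "up (Suc m) L = Pow {1..Suc m}" unfolding up_def by blast
    have "map (bias (up (Suc m) L)) (rev [1..<Suc (Suc m)]) = map (\<lambda>_. 0) (rev [1..<Suc (Suc m)])"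
      unfolding U by (intro map_cong refl bias_Pow_finite) auto
    moreover have "card (up (Suc m) L) = 2 ^ Suc m" unfolding U by (simp add: card_Pow)
    ultimately show ?thesis using 2 by (simp add: map_replicate_const)
  next
    case 3
    let ?U1 = "up m (map tl L)" and ?U0 = "up m (map tl (filter (\<lambda>l. \<not> hd l) L))"
    have IH1: "up_bias m (map tl L) = (int (card ?U1), map (bias ?U1) (rev [1..<Suc m]))"
      using Suc.prems by (intro Suc.IH) simp
    have IH0: "up_bias m (map tl (filter (\<lambda>l. \<not> hd l) L)) =
        (int (card ?U0), map (bias ?U0) (rev [1..<Suc m]))"
      using Suc.prems by (intro Suc.IH) simp
    have U: "up (Suc m) L = insert (Suc m) ` ?U1 \<union> ?U0" by (rule up_Suc) (rule Suc.prems)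
    have disj: "insert (Suc m) ` ?U1 \<inter> ?U0 = {}" using up_subset[of m] Suc_notin by fast
    have "inj_on (insert (Suc m)) ?U1"
      using up_subset[of m] by (intro inj_onI) (metis Diff_insert_absorb PowD Suc_notin subsetD)
    then have card: "card (up (Suc m) L) = card ?U1 + card ?U0"
      unfolding U using disj by (simp add: card_Un_disjoint card_image)
    have bias: "bias (up (Suc m) L) j = (if j = Suc m then int (card ?U1) else bias ?U1 j) + bias ?U0 j" for j
      unfolding U using disj by (simp add: bias_Un_disjoint bias_insert_image[OF up_subset])
    have top: "bias (up (Suc m) L) (Suc m) = int (card ?U1) - int (card ?U0)"
      using bias_notin[OF up_subset, of "Suc m" m] by (simp add: bias)
    have "map2 (+) (map (bias ?U1) xs) (map (bias ?U0) xs) = map (\<lambda>j. bias ?U1 j + bias ?U0 j) xs" for xs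
      by (induction xs) auto
    moreover have "map (bias (up (Suc m) L)) (rev [1..<Suc m])
        = map (\<lambda>j. bias ?U1 j + bias ?U0 j) (rev [1..<Suc m])"
      by (rule map_cong) (auto simp: bias)
    ultimately have rest: "map (bias (up (Suc m) L)) (rev [1..<Suc m])
        = map2 (+) (map (bias ?U1) (rev [1..<Suc m])) (map (bias ?U0) (rev [1..<Suc m]))"
      by simp
    have "up_bias (Suc m) L = (int (card ?U1) + int (card ?U0), (int (card ?U1) - int (card ?U0))
        # map2 (+) (map (bias ?U1) (rev [1..<Suc m])) (map (bias ?U0) (rev [1..<Suc m])))"
      unfolding up_bias.simps(2) IH1 IH0 using 3 by (simp only: if_False Let_def prod.case)
    moreover have "rev [1..<Suc (Suc m)] = Suc m # rev [1..<Suc m]" by simp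
    ultimately show ?thesis by (simp only: list.map top rest card of_nat_add)
  qed
qed

section \<open>Weighted entries and certificates\<close>

text \<open>In an entry, \<open>p\<close> is the list position of the avoided element \<open>n - p\<close>, and \<open>E\<close> lists the
  generators beyond those forced by \<open>As\<close>. A certificate lists \<open>E\<close> and the weight for each
  \<open>p\<close>, so its first component belongs to the element \<open>n\<close>.\<close>

definition entry_family :: "nat \<Rightarrow> bool list list \<Rightarrow> nat \<Rightarrow> bool list list \<Rightarrow> nat set set" where
  "entry_family n As p E = Pow ({1..n} - {n - p}) \<union> up n (E @ filter (\<lambda>a. a ! p) As)"

text \<open>The power set of \<open>{1..n} - {n - p}\<close> has bias 0 at its own elements and
  \<open>- (2 ^ (n - 1))\<close> at \<open>n - p\<close>, so only position \<open>p\<close> of the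
  up-set's vector changes.\<close>

definition entry_bias :: "nat \<Rightarrow> bool list list \<Rightarrow> nat \<Rightarrow> bool list list \<Rightarrow> int list" where
  "entry_bias n As p E =
     (let v = snd (up_bias n (E @ filter (\<lambda>a. a ! p) As)) in v[p := v ! p - 2 ^ (n - 1)])"

fun total_bias :: "nat \<Rightarrow> bool list list \<Rightarrow> (nat \<times> bool list list \<times> int) list \<Rightarrow> int list" where
  "total_bias n As [] = replicate n 0"
| "total_bias n As ((p, E, w) # cs) = map2 (\<lambda>x y. w * x + y) (entry_bias n As p E) (total_bias n As cs)"

text \<open>Nonnegative weights can be read as multiplicities. Generators through
  \<open>n - p\<close> keep the up-set disjoint from the sets avoiding \<open>n - p\<close>, so that
  the biases of the two parts add.\<close>

definition cert :: "nat \<Rightarrow> bool list list \<Rightarrow> (bool list list \<times> int) list \<Rightarrow> bool" where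
  "cert n As ws \<longleftrightarrow> length ws = n \<and> list_all (\<lambda>a. length a = n) As \<and>
     list_all (\<lambda>(p, E, w). 0 \<le> w \<and> list_all (\<lambda>l. length l = n \<and> l ! p) E) (enumerate 0 ws) \<and>
     list_all (\<lambda>x. x < 0) (total_bias n As (enumerate 0 ws))"

context
  fixes n :: nat and As :: "bool list list"
  assumes len: "\<forall>a\<in>set As. length a = n"
begin

context
  fixes p :: nat and E :: "bool list list"
  assumes p: "p < n" and E: "\<forall>l\<in>set E. length l = n \<and> l ! p"
begin

lemma entry_gens:
  assumes "l \<in> set (E @ filter (\<lambda>a. a ! p) As)"
  shows "length l = n" "n - p \<in> dec l"
proof -
  show l: "length l = n" using assms E len by auto
  show "n - p \<in> dec l" using assms E l p diff_mem_dec_iff[of p l] by auto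
qed

lemma mem_up_entry: "X \<in> up n (E @ filter (\<lambda>a. a ! p) As) \<Longrightarrow> n - p \<in> X"
  unfolding up_def using entry_gens(2) by blast

lemma union_closed_entry_family: "union_closed (entry_family n As p E)"
  unfolding union_closed_def
proof (intro ballI)
  fix X Y assume XY: "X \<in> entry_family n As p E" "Y \<in> entry_family n As p E"
  let ?U = "up n (E @ filter (\<lambda>a. a ! p) As)"
  have sub: "X \<subseteq> {1..n}" "Y \<subseteq> {1..n}" using XY unfolding entry_family_def up_def by blast+
  show "X \<union> Y \<in> entry_family n As p E"
  proof (cases "X \<in> ?U \<or> Y \<in> ?U")
    case True
    then have "X \<union> Y \<in> ?U" unfolding up_def using sub by blast
    then show ?thesis unfolding entry_family_def by blast
  next
    case False
    then show ?thesis using XY unfolding entry_family_def by blast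
  qed
qed

text \<open>A member of \<open>As\<close> through \<open>n - p\<close> is itself a generator, so the
  union lies in the up-set. Any other member leaves it undecided only whether \<open>Y\<close>
  contains \<open>n - p\<close>: if so, the up-set absorbs the union; if not, the union still avoids
  \<open>n - p\<close>.\<close>

lemma entry_family_Un_mem:
  assumes a: "a \<in> set As" and Y: "Y \<in> entry_family n As p E"
  shows "dec a \<union> Y \<in> entry_family n As p E"
proof (cases "a ! p")
  case True
  have "Y \<subseteq> {1..n}" using Y unfolding entry_family_def up_def by blast
  moreover have "dec a \<subseteq> {1..n}" using dec_subset[of a] len a by simp
  ultimately have "dec a \<union> Y \<subseteq> {1..n}" by blast
  then have "dec a \<union> Y \<in> up n (E @ filter (\<lambda>a. a ! p) As)"
    unfolding up_def using True a by auto
  then show ?thesis unfolding entry_family_def by blast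
next
  case False
  have la: "length a = n" using len a by blast
  have "n - p \<notin> dec a" using False p diff_mem_dec_iff[of p a] la by simp
  then have a': "dec a \<subseteq> {1..n} - {n - p}" using dec_subset[of a] la by auto
  show ?thesis
  proof (cases "n - p \<in> Y")
    case True
    then have "Y \<in> up n (E @ filter (\<lambda>a. a ! p) As)" using Y unfolding entry_family_def by blast
    then have "dec a \<union> Y \<in> up n (E @ filter (\<lambda>a. a ! p) As)" using a' unfolding up_def by blast
    then show ?thesis unfolding entry_family_def by blast
  next
    case False
    have "Y \<subseteq> {1..n}" using Y unfolding entry_family_def up_def by blast
    then show ?thesis using False a' unfolding entry_family_def by blast
  qed
qed

lemma entry_bias_correct:
  "length (entry_bias n As p E) = n"
  "q < n \<Longrightarrow> entry_bias n As p E ! q = bias (entry_family n As p E) (n - q)"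
proof -
  let ?L = "E @ filter (\<lambda>a. a ! p) As"
  have v: "snd (up_bias n ?L) = map (bias (up n ?L)) (rev [1..<Suc n])"
    using up_bias_correct[of ?L n] entry_gens(1) by simp
  show "length (entry_bias n As p E) = n"
    unfolding entry_bias_def v by (simp add: Let_def)
  assume q: "q < n"
  have nth_rev: "rev [Suc 0..<Suc n] ! r = n - r" if "r < n" for r
    using that by (simp add: rev_nth Suc_diff_Suc del: upt_Suc)
  have disj: "Pow ({1..n} - {n - p}) \<inter> up n ?L = {}"
    using mem_up_entry by blast
  have split: "bias (entry_family n As p E) (n - q) = bias (Pow ({1..n} - {n - p})) (n - q) + bias (up n ?L) (n - q)"
    unfolding entry_family_def using disj by (intro bias_Un_disjoint) auto
  have P: "bias (Pow ({1..n} - {n - p})) (n - q) = (if p = q then - (2 ^ (n - 1)) else 0)"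
  proof (cases "p = q")
    case True
    have "bias (Pow ({1..n} - {n - p})) (n - q) = - int (card (Pow ({1..n} - {n - p})))"
      using True by (intro bias_notin[OF order_refl]) simp
    moreover have "card ({1..n} - {n - p}) = n - 1"
      using p by (subst card_Diff_singleton) auto
    ultimately show ?thesis using True by (simp add: card_Pow)
  next
    case False
    then have "n - q \<in> {1..n} - {n - p}" using p q by auto
    then show ?thesis using False bias_Pow_finite[of "{1..n} - {n - p}"] by simp
  qed
  show "entry_bias n As p E ! q = bias (entry_family n As p E) (n - q)"
    unfolding split P unfolding entry_bias_def v Let_def using p q
    by (cases "p = q") (simp_all add: nth_rev del: upt_Suc)
qed

end

lemma total_bias_correct:
  assumes "\<forall>(p, E, w)\<in>set cs. p < n \<and> (\<forall>l\<in>set E. length l = n \<and> l ! p)"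
  shows "length (total_bias n As cs) = n \<and>
    (\<forall>q<n. total_bias n As cs ! q = (\<Sum>(p, E, w)\<leftarrow>cs. w * bias (entry_family n As p E) (n - q)))"
  using assms
proof (induction cs)
  case (Cons c cs)
  obtain p E w where c: "c = (p, E, w)" by (cases c)
  have "p < n" "\<forall>l\<in>set E. length l = n \<and> l ! p" using Cons.prems c by auto
  note eb = entry_bias_correct[OF this]
  show ?case using Cons by (simp add: c eb)
qed simp

end

lemma cert_imp_not_frankl_complete:
  assumes "cert n As ws"
  shows "\<not> frankl_complete (dec ` set As)"
proof -
  define cs where "cs = enumerate 0 ws"
  have len: "\<forall>a\<in>set As. length a = n" and "length ws = n"
    using assms by (auto simp: cert_def list_all_iff)
  have cs: "p < n" "\<forall>l\<in>set E. length l = n \<and> l ! p" "0 \<le> w" if "(p, E, w) \<in> set cs" for p E w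
  proof -
    show "p < n" using that \<open>length ws = n\<close> by (auto simp: cs_def in_set_enumerate_eq)
    show "\<forall>l\<in>set E. length l = n \<and> l ! p" "0 \<le> w"
      using assms that unfolding cert_def list_all_iff cs_def by blast+
  qed
  \<comment> \<open>Repeating each family as often as its weight turns the weighted sum into a plain
    sum over a list.\<close>
  define Bs where "Bs = concat (map (\<lambda>(p, E, w). replicate (nat w) (entry_family n As p E)) cs)"
  have Bs: "\<exists>p E w. (p, E, w) \<in> set cs \<and> \<B> = entry_family n As p E" if "\<B> \<in> set Bs" for \<B>
    using that by (auto simp: Bs_def)
  show ?thesis
  proof (rule not_frankl_complete_if_sum_bias[of _ n Bs])
    show "dec ` set As \<subseteq> Pow {1..n}" using dec_subset len by fastforce
    fix \<B> assume "\<B> \<in> set Bs"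
    then obtain p E w where pE: "(p, E, w) \<in> set cs" and B: "\<B> = entry_family n As p E"
      using Bs by blast
    note * = len cs(1,2)[OF pE]
    show "\<B> \<subseteq> Pow {1..n}" unfolding B entry_family_def up_def by auto
    show "union_closed \<B>" unfolding B by (rule union_closed_entry_family[OF *])
    show "X \<union> Y \<in> \<B>" if "X \<in> dec ` set As" "Y \<in> \<B>" for X Y
      using that entry_family_Un_mem[OF *] unfolding B by auto
  next
    fix j assume j: "j \<in> {1..n}"
    have tb: "length (total_bias n As cs) = n"
      "\<And>q. q < n \<Longrightarrow> total_bias n As cs ! q = (\<Sum>(p, E, w)\<leftarrow>cs. w * bias (entry_family n As p E) (n - q))"
      using total_bias_correct[OF len, of cs] cs(1,2) by (simp_all add: Ball_def)
    have "(\<Sum>\<B>\<leftarrow>Bs. bias \<B> j) = (\<Sum>(p, E, w)\<leftarrow>cs. int (nat w) * bias (entry_family n As p E) j)"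
      unfolding Bs_def by (induction cs) (auto simp: sum_list_replicate)
    also have "\<dots> = (\<Sum>(p, E, w)\<leftarrow>cs. w * bias (entry_family n As p E) j)"
      using cs(3) by (intro arg_cong[of _ _ sum_list] map_cong) auto
    also have "\<dots> = total_bias n As cs ! (n - j)"
      using j by (subst tb(2)) auto
    also have "\<dots> < 0"
      using assms tb(1) j by (auto simp: cert_def list_all_length cs_def)
    finally show "(\<Sum>\<B>\<leftarrow>Bs. bias \<B> j) < 0" .
  qed
qed

section \<open>From certificates to statements about \<open>FC\<close>\<close>

definition FC_cert :: "nat \<Rightarrow> nat \<Rightarrow> nat \<Rightarrow> bool list list \<Rightarrow> (bool list list \<times> int) list \<Rightarrow> bool" where
  "FC_cert k n m As ws \<longleftrightarrow> cert n As ws \<and> distinct As \<and> length As = m \<and>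
     list_all (\<lambda>a. count_list a True = k) As"

text \<open>A non-FC family with \<open>m\<close> distinct k-sets rules out the value
  \<open>m\<close> itself, hence the successor. Distinct lists of equal length decode to distinct
  sets.\<close>

lemma FC_cert_imp_le_FC:
  assumes "FC_cert k n m As ws"
  shows "FC k n \<ge> Suc m"
proof -
  let ?\<A> = "dec ` set As"
  have len: "\<forall>a\<in>set As. length a = n"
    using assms by (auto simp: FC_cert_def cert_def list_all_iff)
  then have "inj_on dec (set As)" by (intro inj_onI) (simp add: dec_inject)
  then have "card ?\<A> = m"
    using assms by (simp add: card_image distinct_card FC_cert_def)
  then have "contains_k_sets ?\<A> m k"
    using assms unfolding contains_k_sets_def FC_cert_def list_all_iff
    by (intro exI[of _ ?\<A>]) (auto simp: card_dec)
  moreover have "?\<A> \<subseteq> Pow {1..n}" using dec_subset len by fastforce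
  moreover have "\<not> frankl_complete ?\<A>"
    using assms by (intro cert_imp_not_frankl_complete[of n As ws]) (simp add: FC_cert_def)
  ultimately show ?thesis by (subst le_FC_iff) auto
qed

text \<open>\<open>True\<close> comes before \<open>False\<close>, so sets with large elements come
  first; the initial segment used for k = 6, n = 9 depends on this order.\<close>

fun combs :: "nat \<Rightarrow> nat \<Rightarrow> bool list list" where
  "combs 0 k = (if k = 0 then [[]] else [])"
| "combs (Suc n) k =
     (case k of 0 \<Rightarrow> [] | Suc k' \<Rightarrow> map ((#) True) (combs n k')) @ map ((#) False) (combs n k)"

lemma set_combs: "set (combs n k) = {xs. length xs = n \<and> count_list xs True = k}"
proof (induction n arbitrary: k)
  case 0
  then show ?case by auto
next
  case (Suc n)
  show ?case
  proof (rule set_eqI)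
    fix xs
    show "xs \<in> set (combs (Suc n) k) \<longleftrightarrow>
        xs \<in> {xs. length xs = Suc n \<and> count_list xs True = k}"
      by (cases xs) (auto simp: Suc split: nat.splits)
  qed
qed

lemma k_subsets_eq: "k_subsets k n = dec ` set (combs n k)"
proof (intro subset_antisym subsetI)
  fix S assume S: "S \<in> k_subsets k n"
  define xs where "xs = map (\<lambda>j. j \<in> S) (rev [1..<Suc n])"
  have "dec xs = S"
  proof -
    have "dec (map (\<lambda>j. j \<in> S) (rev [1..<Suc m])) = S \<inter> {1..m}" for m
      by (induction m) (auto simp: atLeastAtMostSuc_conv simp del: upt_Suc simp: upt_Suc_append)
    then show ?thesis using S by (auto simp: xs_def k_subsets_def)
  qed
  moreover have "length xs = n" by (simp add: xs_def)
  ultimately show "S \<in> dec ` set (combs n k)"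
    using S card_dec[of xs] by (auto simp: set_combs k_subsets_def intro!: image_eqI[of _ _ xs])
next
  fix S assume "S \<in> dec ` set (combs n k)"
  then show "S \<in> k_subsets k n"
    using dec_subset by (fastforce simp: set_combs k_subsets_def card_dec)
qed

lemma cert_imp_FC_undefined:
  assumes "cert n (combs n k) ws"
  shows "FC_undefined k n"
  using cert_imp_not_frankl_complete[OF assms] by (simp add: FC_undefined_def k_subsets_eq)

definition bits :: "nat \<Rightarrow> nat list \<Rightarrow> bool list" where
  "bits n xs = map (\<lambda>j. List.member xs j) (rev [1..<Suc n])"

section \<open>Certificates for the lower bounds\<close>

text \<open>The sets are \<open>{9, 8}\<close> joined with the 11 pairs in \<open>{1..7}\<close>
  that meet \<open>{7, 6}\<close>, and two further sets inside \<open>{1..5}\<close>.\<close>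

lemma FC_cert_9_4:
  "FC_cert 4 9 13
    (map (\<lambda>l. True # True # l) (filter (\<lambda>l. l ! 0 \<or> l ! 1) (combs 7 2)) @
     [bits 9 [5, 4, 3, 2], bits 9 [5, 4, 3, 1]])
    (map (Pair []) [16, 16, 6, 6, 2, 2, 2, 1, 1])"
  by code_simp

text \<open>The same pattern with 13 pairs in \<open>{1..8}\<close> meeting \<open>{8, 7}\<close>;
  the element 6 lies in neither of the two further sets and gets its own weight.\<close>

lemma FC_cert_10_4:
  "FC_cert 4 10 15
    (map (\<lambda>l. True # True # l) (filter (\<lambda>l. l ! 0 \<or> l ! 1) (combs 8 2)) @
     [bits 10 [5, 4, 3, 2], bits 10 [5, 4, 3, 1]])
    (map (Pair []) [21, 21, 8, 8, 1, 2, 2, 2, 1, 1])"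
  by code_simp

lemma FC_cert_8_5:
  "FC_cert 5 8 20 (map (\<lambda>l. True # True # l) (combs 6 3))
    (map (Pair []) [4, 4, 1, 1, 1, 1, 1, 1])"
  by code_simp

text \<open>Of the 35 triples in \<open>{1..7}\<close>, the four missing \<open>{7, 6, 5}\<close>
  and this triple itself are dropped. Each of the 30 sets contains a member of \<open>E\<close>, so
  for 9 and 8 the up-set consists of the sets containing \<open>{9, 8}\<close> and one of 7, 6,
  5.\<close>

lemma FC_cert_9_5:
  "FC_cert 5 9 30
    (map (\<lambda>l. True # True # l) (filter (\<lambda>l. (l ! 0 \<or> l ! 1 \<or> l ! 2) \<and> l \<noteq> bits 7 [7, 6, 5]) (combs 7 3)))
    (let E = [bits 9 [9, 8, 7], bits 9 [9, 8, 6], bits 9 [9, 8, 5]]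
     in [(E, 188), (E, 188)] @ map (Pair []) [32, 32, 32, 3, 3, 3, 3])"
  by code_simp

text \<open>With the single generator \<open>{10, 9, x}\<close> in the entry for each \<open>x = 8, 7, 6\<close>, the weights
  \<open>6, 6, 1, 1, 1\<close> of the entries for 10, 9, 8, 7, 6 would make all biases cancel exactly. The
  deleted sets allow a slightly better entry for 6, hence the large weights close to that ratio.\<close>

lemma FC_cert_10_5:
  "FC_cert 5 10 43
    (map (\<lambda>l. True # True # l)
      (filter (\<lambda>l. (l ! 0 \<or> l ! 1 \<or> l ! 2) \<and>
           l \<notin> set [bits 8 [8, 7, 6], bits 8 [8, 6, 5], bits 8 [7, 6, 5]]) (combs 8 3)))
    (let E = [bits 10 [10, 9, 8], bits 10 [10, 9, 7], bits 10 [10, 9, 6]];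
         E' = (\<lambda>j. [bits 10 [10, 9, 8, j], bits 10 [10, 9, 7, j], bits 10 [10, 9, 6, j]])
     in [(E, 10299), (E, 10299), ([bits 10 [10, 9, 8]], 1723), ([bits 10 [10, 9, 7]], 1723),
         (map (\<lambda>j. bits 10 [10, 9, 6, j]) [4, 3, 2, 1], 1688),
         (E' 5, 1), (E' 4, 34), (E' 3, 34), (E' 2, 34), (E' 1, 34)])"
  by code_simp

text \<open>The segment gives all 35 6-sets containing \<open>{9, 8}\<close>, followed by
  \<open>{9, 7, 6, 5}\<close> joined with the 6 pairs in \<open>{1..4}\<close>. The weights are
  constant on \<open>{7, 6, 5}\<close> and on \<open>{1..4}\<close>, as this symmetry
  suggests.\<close>

lemma FC_cert_9_6:
  "FC_cert 6 9 41 (map ((#) True) (take 41 (combs 8 5)))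
    (map (Pair []) [19, 14, 8, 8, 8, 6, 6, 6, 6])"
  by code_simp

lemma FC_cert_10_6:
  "FC_cert 6 10 70 (map (\<lambda>l. True # True # l) (combs 8 4))
    (map (Pair []) [13, 13, 3, 3, 3, 3, 3, 3, 3, 3])"
  by code_simp

lemma FC_cert_10_7:
  "FC_cert 7 10 84 (map ((#) True) (combs 9 6))
    (map (Pair []) [7, 3, 3, 3, 3, 3, 3, 3, 3, 3])"
  by code_simp

section \<open>Certificates for the undefined cases\<close>

text \<open>The family of all k-sets is invariant under permutations of the ground set, so equal
  weights are the natural choice, here and in the next six certificates.\<close>

lemma cert_6_5: "cert 6 (combs 6 5) (replicate 6 ([], 1))"
  by code_simp

lemma cert_7_6: "cert 7 (combs 7 6) (replicate 7 ([], 1))"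
  by code_simp

lemma cert_8_7: "cert 8 (combs 8 7) (replicate 8 ([], 1))"
  by code_simp

lemma cert_9_7: "cert 9 (combs 9 7) (replicate 9 ([], 1))"
  by code_simp

lemma cert_9_8: "cert 9 (combs 9 8) (replicate 9 ([], 1))"
  by code_simp

lemma cert_10_8: "cert 10 (combs 10 8) (replicate 10 ([], 1))"
  by code_simp

lemma cert_10_9: "cert 10 (combs 10 9) (replicate 10 ([], 1))"
  by code_simp

theorem theorem2p6:
  "FC 4 9 \<ge> 14 \<and> FC 4 10 \<ge> 16 \<and>
   FC 5 8 \<ge> 21 \<and> FC 5 9 \<ge> 31 \<and> FC 5 10 \<ge> 44 \<and>
   FC 6 9 \<ge> 42 \<and> FC 6 10 \<ge> 71 \<and>
   FC 7 10 \<ge> 85 \<and>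
   (\<forall>k n. 5 \<le> k \<and> k < n \<and> n \<le> 10 \<and>
      (k, n) \<notin> {(5,7), (5,8), (5,9), (5,10), (6,8), (6,9), (6,10), (7,10)} \<longrightarrow>
      FC_undefined k n)"
proof (intro conjI allI impI)
  fix k n :: nat
  assume kn: "5 \<le> k \<and> k < n \<and> n \<le> 10 \<and>
      (k, n) \<notin> {(5,7), (5,8), (5,9), (5,10), (6,8), (6,9), (6,10), (7,10)}"
  then have k: "k = 5 \<or> k = 6 \<or> k = 7 \<or> k = 8 \<or> k = 9"
    and n: "n = 6 \<or> n = 7 \<or> n = 8 \<or> n = 9 \<or> n = 10"
    by linarith+
  \<comment> \<open>Of the 15 pairs in range, the 8 exceptions leave these 7.\<close>
  from k n have "(k, n) \<in> {(5, 6), (6, 7), (7, 8), (7, 9), (8, 9), (8, 10), (9, 10)}"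
    using kn by (elim disjE; simp)
  then show "FC_undefined k n"
    using cert_6_5[THEN cert_imp_FC_undefined]
      cert_7_6[THEN cert_imp_FC_undefined]
      cert_8_7[THEN cert_imp_FC_undefined]
      cert_9_7[THEN cert_imp_FC_undefined]
      cert_9_8[THEN cert_imp_FC_undefined]
      cert_10_8[THEN cert_imp_FC_undefined]
      cert_10_9[THEN cert_imp_FC_undefined]
    by auto
qed (use FC_cert_9_4[THEN FC_cert_imp_le_FC] FC_cert_10_4[THEN FC_cert_imp_le_FC]
    FC_cert_8_5[THEN FC_cert_imp_le_FC] FC_cert_9_5[THEN FC_cert_imp_le_FC]
    FC_cert_10_5[THEN FC_cert_imp_le_FC] FC_cert_9_6[THEN FC_cert_imp_le_FC]
    FC_cert_10_6[THEN FC_cert_imp_le_FC] FC_cert_10_7[THEN FC_cert_imp_le_FC] in linarith)+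

end
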